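(* Let $\eta\in\mathbb{R}$, let $G$ be a (weakly connected) digraph equipped with its $\eta$-function $\theta$, and let $U_\theta=S_\theta C$ be its transfer matrix. Let $m_{1}$ and $m_{-1}$ denote the multiplicities of the eigenvalues $1$ and $-1$ of $\tilde H_\eta(G)$. Then, as multisets, \[\mathrm{Spec}(U_\theta)=\varphi^{-1}(\mathrm{Spec}(\tilde H_\eta(G)))\cup\{1\}^{M_1}\cup\{-1\}^{M_{-1}},\] where $M_\varepsilon=\max\{0,\,|E(G^{\pm})|-|V(G^{\pm})|+m_\varepsilon\}$ for $\varepsilon\in\{\pm1\}$.
   Context: A digraph $G$ has finite vertex set $V(G)$ and arc set $A(G)\subseteq V(G)\times V(G)\setminus\{(x,x)\}$. For $a=(u,v)$: $o(a)=u$, $t(a)=v$, $a^{-1}=(v,u)$; $A(G)^{\pm1}=A(G)\cup A(G)^{-1}$ where $A(G)^{-1}=\{a^{-1}\mid a\in A(G)\}$. The underlying graph $G^{\pm}=(V(G),A(G)^{\pm1})$ is a simple undirected graph (edge set $E(G^{\pm})$), assumed connected; $\deg x=\deg_{G^{\pm}}x$. The $\eta$-function: $\theta(a)=\eta$ if $a\in A(G)\setminus A(G)^{-1}$, $-\eta$ if $a\in A(G)^{-1}\setminus A(G)$, $0$ if $a\in A(G)\cap A(G)^{-1}$. Matrices: $K$ (rows $V(G)$, columns $A(G)^{\pm1}$) with $K_{v,a}=\delta_{v,t(a)}/\sqrt{\deg t(a)}$; $C=2K^*K-I$; $S_\theta$ indexed by $A(G)^{\pm1}$ with $(S_\theta)_{ab}=e^{i\theta(b)}\delta_{a,b^{-1}}$;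 $U_\theta=S_\theta C$. $H_\eta(G)$ is indexed by $V(G)$ with entry $1$ on digons ($(x,y)\in A(G)\cap A(G)^{-1}$), $e^{i\eta}$ if $(x,y)\in A(G)\setminus A(G)^{-1}$, $e^{-i\eta}$ if $(x,y)\in A(G)^{-1}\setminus A(G)$, $0$ otherwise; $\tilde H_\eta(G)=D^{-1/2}H_\eta(G)D^{-1/2}$ with $D$ the diagonal degree matrix. $\varphi(z)=(z+z^{-1})/2$ on the unit circle; $\varphi^{-1}(\mathrm{Spec}(\tilde H_\eta(G)))$ denotes the multiset in which each eigenvalue $\lambda\in(-1,1)$ of multiplicity $m$ contributes the two points $e^{\pm i\arccos\lambda}$ each with multiplicity $m$, and $\lambda=\pm1$ of multiplicity $m$ contributes $\pm1$ with multiplicity $m$. *)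

theory Defs
  imports
    "Graph_Theory.Digraph_Component"
    "Jordan_Normal_Form.Char_Poly"
    "Jordan_Normal_Form.Schur_Decomposition"
    "HOL-Computational_Algebra.Polynomial"
begin

text \<open>
  A digraph is a \<open>pair_digraph\<close>: finitely many vertices, arcs are pairs of distinct vertices.
\<close>

definition sym_arcs :: "'a pair_pre_digraph \<Rightarrow> ('a \<times> 'a) set" where
  "sym_arcs G = parcs G \<union> (parcs G)\<inverse>"

definition sym_edges :: "'a pair_pre_digraph \<Rightarrow> 'a set set" where
  "sym_edges G = {{x, y} | x y. (x, y) \<in> sym_arcs G}"

definition deg :: "'a pair_pre_digraph \<Rightarrow> 'a \<Rightarrow> nat" where
  "deg G x = card {e \<in> sym_edges G. x \<in> e}"

abbreviation arc_inv :: "'a \<times> 'a \<Rightarrow> 'a \<times> 'a" where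
  "arc_inv \<equiv> prod.swap"

text \<open>The value outside \<open>sym_arcs G\<close> is irrelevant.\<close>

definition eta_fun :: "'a pair_pre_digraph \<Rightarrow> real \<Rightarrow> 'a \<times> 'a \<Rightarrow> real" where
  "eta_fun G \<eta> a =
     (if a \<in> parcs G - (parcs G)\<inverse> then \<eta>
      else if a \<in> (parcs G)\<inverse> - parcs G then - \<eta>
      else 0)"

text \<open>
  Matrices over finite index sets are represented relative to enumerations of these sets:
  \<open>vs\<close> enumerates the vertices and \<open>as\<close> enumerates \<open>sym_arcs G\<close>.
\<close>

definition mat_on :: "'i list \<Rightarrow> 'j list \<Rightarrow> ('i \<Rightarrow> 'j \<Rightarrow> 'c) \<Rightarrow> 'c mat" where
  "mat_on rs cs f = mat (length rs) (length cs) (\<lambda>(i, j). f (rs ! i) (cs ! j))"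

definition K_mat :: "'a pair_pre_digraph \<Rightarrow> 'a list \<Rightarrow> ('a \<times> 'a) list \<Rightarrow> complex mat" where
  "K_mat G vs as =
     mat_on vs as (\<lambda>v a. if v = snd a then 1 / complex_of_real (sqrt (real (deg G (snd a)))) else 0)"

definition C_mat :: "'a pair_pre_digraph \<Rightarrow> 'a list \<Rightarrow> ('a \<times> 'a) list \<Rightarrow> complex mat" where
  "C_mat G vs as =
     2 \<cdot>\<^sub>m (mat_adjoint (K_mat G vs as) * K_mat G vs as) - 1\<^sub>m (length as)"

definition S_mat :: "('a \<times> 'a \<Rightarrow> real) \<Rightarrow> ('a \<times> 'a) list \<Rightarrow> complex mat" where
  "S_mat \<theta> as = mat_on as as (\<lambda>a b. if a = arc_inv b then cis (\<theta> b) else 0)"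

definition U_mat ::
  "'a pair_pre_digraph \<Rightarrow> ('a \<times> 'a \<Rightarrow> real) \<Rightarrow> 'a list \<Rightarrow> ('a \<times> 'a) list \<Rightarrow> complex mat" where
  "U_mat G \<theta> vs as = S_mat \<theta> as * C_mat G vs as"

definition H_mat :: "'a pair_pre_digraph \<Rightarrow> real \<Rightarrow> 'a list \<Rightarrow> complex mat" where
  "H_mat G \<eta> vs = mat_on vs vs (\<lambda>x y.
     if (x, y) \<in> parcs G \<inter> (parcs G)\<inverse> then 1
     else if (x, y) \<in> parcs G - (parcs G)\<inverse> then cis \<eta>
     else if (x, y) \<in> (parcs G)\<inverse> - parcs G then cis (- \<eta>)
     else 0)"

definition D_inv_sqrt :: "'a pair_pre_digraph \<Rightarrow> 'a list \<Rightarrow> complex mat" where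
  "D_inv_sqrt G vs =
     mat_on vs vs (\<lambda>x y. if x = y then 1 / complex_of_real (sqrt (real (deg G x))) else 0)"

definition H_norm :: "'a pair_pre_digraph \<Rightarrow> real \<Rightarrow> 'a list \<Rightarrow> complex mat" where
  "H_norm G \<eta> vs = D_inv_sqrt G vs * H_mat G \<eta> vs * D_inv_sqrt G vs"

text \<open>The multiset of eigenvalues, counted with algebraic multiplicity.\<close>

definition Spec :: "complex mat \<Rightarrow> complex multiset" where
  "Spec A = proots (char_poly A)"

definition phi :: "complex \<Rightarrow> complex" where
  "phi z = (z + inverse z) / 2"

text \<open>
  The last branch covers the numbers outside the real interval \<open>[-1, 1]\<close>, which have no preimage
  under \<^const>\<open>phi\<close> on the unit circle.
\<close>

definition phi_fibre :: "complex \<Rightarrow> complex multiset" where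
  "phi_fibre l =
     (if l = 1 \<or> l = -1 then {#l#}
      else if l \<in> \<real> \<and> -1 < Re l \<and> Re l < 1
        then {#cis (arccos (Re l)), cis (- arccos (Re l))#}
      else {#})"

definition phi_preimage :: "complex multiset \<Rightarrow> complex multiset" where
  "phi_preimage \<Lambda> = (\<Sum>l\<in>#\<Lambda>. phi_fibre l)"

lemma phi_unit_circle:
  assumes "cmod z = 1"
  shows "phi z = complex_of_real (Re z)"
proof -
  have "inverse z = cnj z"
    using assms by (simp add: complex_eq_iff cmod_def)
  then show ?thesis
    by (simp add: phi_def complex_eq_iff)
qed

lemma phi_fibre_eq: "phi_fibre l = mset_set {z. cmod z = 1 \<and> phi z = l}"
proof -
  let ?F = "{z. cmod z = 1 \<and> phi z = l}"
  have F: "?F = {z. cmod z = 1 \<and> complex_of_real (Re z) = l}"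
    by (auto simp: phi_unit_circle)
  consider (pm) "l = 1 \<or> l = -1"
    | (int) "l \<in> \<real>" "-1 < Re l" "Re l < 1"
    | (out) "\<not> (l = 1 \<or> l = -1)" "\<not> (l \<in> \<real> \<and> -1 < Re l \<and> Re l < 1)"
    by blast
  then show ?thesis
  proof cases
    case pm
    then have "?F = {l}"
      unfolding F by (auto simp: complex_eq_iff cmod_def)
    with pm show ?thesis by (simp add: phi_fibre_def)
  next
    case int
    define t where "t = arccos (Re l)"
    have t: "cos t = Re l" "0 < t" "t < pi"
      using int arccos_lt_bounded[of "Re l"] by (auto simp: t_def)
    have st: "sin t > 0" using t by (simp add: sin_gt_zero)
    have "?F = {cis t, cis (- t)}"
    proof (intro equalityI subsetI)
      fix z assume "z \<in> ?F"
      then have z: "cmod z = 1" "Re z = cos t"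
        unfolding F using t by auto
      then have "(Im z)\<^sup>2 = (sin t)\<^sup>2"
        by (simp add: cmod_def sin_squared_eq)
      then have "Im z = sin t \<or> Im z = - sin t"
        by (simp add: power2_eq_iff)
      with z show "z \<in> {cis t, cis (- t)}"
        by (auto simp: complex_eq_iff)
    next
      fix z assume "z \<in> {cis t, cis (- t)}"
      then have "Re z = cos t" "cmod z = 1" by (auto simp del: cis_cnj)
      then show "z \<in> ?F"
        unfolding F using t int by (auto simp: complex_eq_iff complex_is_Real_iff)
    qed
    moreover have "cis t \<noteq> cis (- t)"
      using st by (auto simp: complex_eq_iff)
    moreover have "\<not> (l = 1 \<or> l = -1)" using int by auto
    ultimately show ?thesis
      using int by (simp add: phi_fibre_def t_def)
  next
    case out
    have "?F = {}"
    proof (rule ccontr)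
      assume "?F \<noteq> {}"
      then obtain z where z: "cmod z = 1" "l = complex_of_real (Re z)"
        unfolding F by auto
      have "\<bar>Re z\<bar> \<le> 1" using abs_Re_le_cmod[of z] z by simp
      with out z show False by (auto simp: complex_eq_iff)
    qed
    moreover have "phi_fibre l = {#}"
      unfolding phi_fibre_def using out by auto
    ultimately show ?thesis by (simp only: mset_set.empty)
  qed
qed

text \<open>The number $M_\varepsilon$, with \<open>m\<close> the multiplicity of the eigenvalue $\varepsilon$.\<close>

definition extra_mult :: "'a pair_pre_digraph \<Rightarrow> nat \<Rightarrow> nat" where
  "extra_mult G m =
     nat (max 0 (int (card (sym_edges G)) - int (card (pverts G)) + int m))"

end

theory Submission
  imports Defs
begin

text \<open>
  Put \<open>T = K S K\<^sup>*\<close>, which equals the normalised Hermitian adjacency matrix, and write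
  \<open>e\<close>, \<open>n\<close> for the numbers of edges and vertices. Choosing one arc of each edge gives
  \<open>2e \<times> e\<close> matrices \<open>P\<close>, \<open>Q\<close> with \<open>S = P P\<^sup>* - 1 = 1 - Q Q\<^sup>*\<close>. By the determinant identity
  \<open>w\<^sup>n det (w - A B) = w\<^sup>m det (w - B A)\<close>, the characteristic polynomial of \<open>U\<close> satisfies
  \<open>(z\<^sup>2 - 1)\<^sup>n \<chi>(z) = (z\<^sup>2 - 1)\<^sup>e \<Prod> (z\<^sup>2 - 2 \<lambda> z + 1)\<close>, where \<open>\<lambda>\<close> runs over the
  spectrum of \<open>T\<close>. Finally \<open>T + 1 = (K P) (K P)\<^sup>*\<close> and \<open>1 - T = (K Q) (K Q)\<^sup>*\<close> show that
  \<open>-1 \<le> \<lambda> \<le> 1\<close>, and, since \<open>K P\<close> and \<open>K Q\<close> have \<open>e\<close> columns, that \<open>\<plusminus>1\<close> have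
  multiplicity at least \<open>n - e\<close> in the spectrum of \<open>T\<close>.
\<close>

section \<open>Comparing \<open>A * B\<close> with \<open>B * A\<close>: determinants and
  spectra\<close>

text \<open>Both sides equal \<open>w ^ n * det M\<close> for the block matrix \<open>M\<close> with
  rows \<open>(w, A)\<close> and \<open>(B, 1)\<close>. Multiplying \<open>M\<close> by
  \<open>L\<close> on the right or by \<open>R\<close> on the left clears its lower left block; here
  \<open>det L = 1\<close> and \<open>det R = w ^ n\<close>. Nothing is divided by \<open>w\<close>,
  so \<open>w = 0\<close> is covered as well.\<close>

lemma det_smult_one_minus_mult_comm:
  fixes A B :: "'a :: idom mat"
  assumes A: "A \<in> carrier_mat m n" and B: "B \<in> carrier_mat n m"
  shows "w ^ n * det (w \<cdot>\<^sub>m 1\<^sub>m m - A * B) = w ^ m * det (w \<cdot>\<^sub>m 1\<^sub>m n - B * A)"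
proof -
  define M where "M = four_block_mat (w \<cdot>\<^sub>m 1\<^sub>m m) A B (1\<^sub>m n)"
  define L where "L = four_block_mat (1\<^sub>m m) (0\<^sub>m m n) (- B) (1\<^sub>m n)"
  define R where "R = four_block_mat (1\<^sub>m m) (0\<^sub>m m n) (- B) (w \<cdot>\<^sub>m 1\<^sub>m n)"
  have AB: "A * B \<in> carrier_mat m m" and BA: "B * A \<in> carrier_mat n n"
    using A B by auto
  have M: "M \<in> carrier_mat (m + n) (m + n)" and L: "L \<in> carrier_mat (m + n) (m + n)"
    and R: "R \<in> carrier_mat (m + n) (m + n)"
    unfolding M_def L_def R_def by auto
  have "M * L = four_block_mat (w \<cdot>\<^sub>m 1\<^sub>m m * 1\<^sub>m m + A * - B) (w \<cdot>\<^sub>m 1\<^sub>m m * 0\<^sub>m m n + A * 1\<^sub>m n)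
      (B * 1\<^sub>m m + 1\<^sub>m n * - B) (B * 0\<^sub>m m n + 1\<^sub>m n * 1\<^sub>m n)"
    unfolding M_def L_def by (rule mult_four_block_mat) (use A B in auto)
  also have "w \<cdot>\<^sub>m 1\<^sub>m m * 1\<^sub>m m + A * - B = w \<cdot>\<^sub>m 1\<^sub>m m - A * B"
    using A B by (intro eq_matI) auto
  also have "w \<cdot>\<^sub>m 1\<^sub>m m * 0\<^sub>m m n + A * 1\<^sub>m n = A"
    using A B by auto
  also have "B * 1\<^sub>m m + 1\<^sub>m n * - B = 0\<^sub>m n m"
    using A B by (intro eq_matI) auto
  also have "B * 0\<^sub>m m n + 1\<^sub>m n * 1\<^sub>m n = 1\<^sub>m n"
    using A B by auto
  finally have "det (M * L) = det (w \<cdot>\<^sub>m 1\<^sub>m m - A * B)"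
    using A minus_carrier_mat[OF AB]
      det_four_block_mat_lower_left_zero[of "w \<cdot>\<^sub>m 1\<^sub>m m - A * B" m A n "0\<^sub>m n m" "1\<^sub>m n"]
    by simp
  moreover have "det L = 1"
    unfolding L_def using B
    by (subst det_four_block_mat_upper_right_zero[of _ m _ n]) auto
  ultimately have 1: "det M = det (w \<cdot>\<^sub>m 1\<^sub>m m - A * B)"
    using det_mult[OF M L] by simp
  have "R * M = four_block_mat (1\<^sub>m m * (w \<cdot>\<^sub>m 1\<^sub>m m) + 0\<^sub>m m n * B) (1\<^sub>m m * A + 0\<^sub>m m n * 1\<^sub>m n)
      (- B * (w \<cdot>\<^sub>m 1\<^sub>m m) + w \<cdot>\<^sub>m 1\<^sub>m n * B) (- B * A + w \<cdot>\<^sub>m 1\<^sub>m n * 1\<^sub>m n)"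
    unfolding M_def R_def by (rule mult_four_block_mat) (use A B in auto)
  also have "1\<^sub>m m * (w \<cdot>\<^sub>m 1\<^sub>m m) + 0\<^sub>m m n * B = w \<cdot>\<^sub>m 1\<^sub>m m"
    using A B by auto
  also have "1\<^sub>m m * A + 0\<^sub>m m n * 1\<^sub>m n = A"
    using A B by auto
  also have "- B * (w \<cdot>\<^sub>m 1\<^sub>m m) + w \<cdot>\<^sub>m 1\<^sub>m n * B = 0\<^sub>m n m"
    using A B by (intro eq_matI) auto
  also have "- B * A + w \<cdot>\<^sub>m 1\<^sub>m n * 1\<^sub>m n = w \<cdot>\<^sub>m 1\<^sub>m n - B * A"
    using A B by (intro eq_matI) auto
  finally have "det (R * M) = w ^ m * det (w \<cdot>\<^sub>m 1\<^sub>m n - B * A)"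
    using A minus_carrier_mat[OF BA]
      det_four_block_mat_lower_left_zero[of "w \<cdot>\<^sub>m 1\<^sub>m m" m A n "0\<^sub>m n m" "w \<cdot>\<^sub>m 1\<^sub>m n - B * A"]
    by simp
  moreover have "det R = w ^ n"
    unfolding R_def using B
    by (subst det_four_block_mat_upper_right_zero[of _ m _ n]) auto
  ultimately show ?thesis
    using det_mult[OF R M] 1 by simp
qed

lemma poly_char_poly:
  fixes A :: "'a :: field mat"
  assumes "A \<in> carrier_mat n n"
  shows "poly (char_poly A) z = det (z \<cdot>\<^sub>m 1\<^sub>m n - A)"
proof -
  have "- char_matrix A z = z \<cdot>\<^sub>m 1\<^sub>m n - A"
    using assms by (intro eq_matI) (auto simp: char_matrix_def)
  then show ?thesis
    using char_poly_matrix[OF assms] by simp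
qed

text \<open>At each point \<open>z\<close> this is the determinant identity with
  \<open>w = z - c\<close>. The shift is present because the products to be compared occur as
  \<open>T + 1\<close> and \<open>1 - T\<close>.\<close>

lemma char_poly_shift_mult_comm:
  fixes A B :: "complex mat"
  assumes A: "A \<in> carrier_mat m n" and B: "B \<in> carrier_mat n m"
  shows "[:-c, 1:] ^ n * char_poly (c \<cdot>\<^sub>m 1\<^sub>m m + A * B)
       = [:-c, 1:] ^ m * char_poly (c \<cdot>\<^sub>m 1\<^sub>m n + B * A)"
proof (rule poly_ext)
  fix z
  have "z \<cdot>\<^sub>m 1\<^sub>m m - (c \<cdot>\<^sub>m 1\<^sub>m m + A * B) = (z - c) \<cdot>\<^sub>m 1\<^sub>m m - A * B"
       "z \<cdot>\<^sub>m 1\<^sub>m n - (c \<cdot>\<^sub>m 1\<^sub>m n + B * A) = (z - c) \<cdot>\<^sub>m 1\<^sub>m n - B * A"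
    using A B by (auto intro!: eq_matI simp: algebra_simps)
  moreover have "c \<cdot>\<^sub>m 1\<^sub>m m + A * B \<in> carrier_mat m m" "c \<cdot>\<^sub>m 1\<^sub>m n + B * A \<in> carrier_mat n n"
    using A B by auto
  ultimately show "poly ([:-c, 1:] ^ n * char_poly (c \<cdot>\<^sub>m 1\<^sub>m m + A * B)) z
      = poly ([:-c, 1:] ^ m * char_poly (c \<cdot>\<^sub>m 1\<^sub>m n + B * A)) z"
    using det_smult_one_minus_mult_comm[OF A B, of "z - c"]
    by (simp add: poly_char_poly poly_power)
qed

lemma char_poly_nonzero: "A \<in> carrier_mat n n \<Longrightarrow> char_poly A \<noteq> (0 :: 'a :: field poly)"
  using degree_monic_char_poly[of A n] by auto

lemma Spec_shift_mult_comm: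
  assumes A: "A \<in> carrier_mat m n" and B: "B \<in> carrier_mat n m"
  shows "replicate_mset n c + Spec (c \<cdot>\<^sub>m 1\<^sub>m m + A * B)
       = replicate_mset m c + Spec (c \<cdot>\<^sub>m 1\<^sub>m n + B * A)"
proof -
  have "char_poly (c \<cdot>\<^sub>m 1\<^sub>m m + A * B) \<noteq> 0" "char_poly (c \<cdot>\<^sub>m 1\<^sub>m n + B * A) \<noteq> 0"
    using A B by (auto intro!: char_poly_nonzero)
  then show ?thesis
    using arg_cong[OF char_poly_shift_mult_comm[OF A B, of c], of proots]
    by (simp add: Spec_def proots_mult proots_power)
qed

lemma char_poly_eq_prod_Spec:
  assumes "A \<in> carrier_mat n n"
  shows "char_poly A = (\<Prod>l\<in>#Spec A. [:- l, 1:])" and "size (Spec A) = n"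
proof -
  obtain ls where ls: "char_poly A = (\<Prod>l\<leftarrow>ls. [:- l, 1:])" "length ls = n"
    using char_poly_factorized[OF assms] by blast
  have "proots (\<Prod>l\<leftarrow>ls. [:- l, 1:]) = mset ls" for ls :: "complex list"
  proof (induction ls)
    case (Cons l ls)
    have "(\<Prod>l\<leftarrow>ls. [:- l, 1:]) \<noteq> 0"
      by (auto simp: prod_list_zero_iff)
    then have "proots ([:- l, 1:] * (\<Prod>l\<leftarrow>ls. [:- l, 1:])) = {#l#} + mset ls"
      using Cons by (subst proots_mult) auto
    then show ?case by (simp del: mult_pCons_left)
  qed simp
  then have "Spec A = mset ls"
    unfolding Spec_def ls(1) .
  then show "char_poly A = (\<Prod>l\<in>#Spec A. [:- l, 1:])" "size (Spec A) = n"
    using ls by (simp_all flip: mset_map add: prod_mset_prod_list)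
qed

section \<open>Adjoints and positive semidefiniteness\<close>

lemma mat_adjoint_carrier [simp]: "A \<in> carrier_mat n m \<Longrightarrow> mat_adjoint A \<in> carrier_mat m n"
  unfolding mat_adjoint_def by auto

lemma mat_adjoint_dim [simp]: "dim_row (mat_adjoint A) = dim_col A" "dim_col (mat_adjoint A) = dim_row A"
  unfolding mat_adjoint_def by auto

lemma mat_adjoint_eq: "mat_adjoint A = mat (dim_col A) (dim_row A) (\<lambda>(i, j). conjugate (A $$ (j, i)))"
  unfolding mat_adjoint_def by (intro eq_matI) (auto simp: mat_of_rows_def)

lemma cscalar_prod_mult_mat_vec:
  fixes A :: "complex mat"
  assumes A: "A \<in> carrier_mat n m" and u: "u \<in> carrier_vec m" and v: "v \<in> carrier_vec n"
  shows "(A *\<^sub>v u) \<bullet>c v = u \<bullet>c (mat_adjoint A *\<^sub>v v)"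
proof -
  have "transpose_mat A *\<^sub>v conjugate v = conjugate (mat_adjoint A *\<^sub>v v)"
    using A v
    by (intro eq_vecI) (auto simp: mat_adjoint_eq scalar_prod_def)
  moreover have "(A *\<^sub>v u) \<bullet>c v = u \<bullet> (transpose_mat A *\<^sub>v conjugate v)"
    using transpose_vec_mult_scalar[of A n m u "conjugate v"] A u v
    by (metis carrier_vec_conjugate comm_scalar_prod mult_mat_vec_carrier transpose_carrier_mat)
  ultimately show ?thesis by simp
qed

text \<open>For an eigenvector \<open>v\<close>, the number \<open>l\<close> times the squared norm
  of \<open>v\<close> is the squared norm of \<open>mat_adjoint M *\<^sub>v v\<close>. The order is
  the one on complex numbers, so the conclusion also makes \<open>l\<close> real.\<close>

lemma eigenvalue_mult_adjoint_nonneg: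
  fixes M :: "complex mat"
  assumes M: "M \<in> carrier_mat n m" and "eigenvalue (M * mat_adjoint M) l"
  shows "l \<ge> 0"
proof -
  obtain v where v: "v \<in> carrier_vec n" "v \<noteq> 0\<^sub>v n" "(M * mat_adjoint M) *\<^sub>v v = l \<cdot>\<^sub>v v"
    using assms unfolding eigenvalue_def eigenvector_def by auto
  define w where "w = mat_adjoint M *\<^sub>v v"
  have w: "w \<in> carrier_vec m"
    unfolding w_def using mat_adjoint_carrier[OF M] v(1) by (rule mult_mat_vec_carrier)
  have "l * (v \<bullet>c v) = (M *\<^sub>v w) \<bullet>c v"
    using M v by (simp add: w_def assoc_mult_mat_vec[of _ n m _ n, symmetric])
  also have "\<dots> = w \<bullet>c w"
    using cscalar_prod_mult_mat_vec[OF M w v(1)] by (simp add: w_def)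
  finally have "l * (v \<bullet>c v) \<ge> 0"
    by (metis conjugate_square_ge_0_vec)
  moreover have "v \<bullet>c v > 0"
    using v by (simp add: conjugate_square_greater_0_vec)
  ultimately show ?thesis
    by (cases l) (auto simp: less_eq_complex_def less_complex_def zero_le_mult_iff)
qed

section \<open>The characteristic polynomial of an abstract transfer matrix\<close>

text \<open>The factor \<open>z - S\<close> turns the problem into a perturbation of a scalar
  matrix: with \<open>W = L * K\<close> and \<open>S * S = 1\<close>, the product of
  \<open>z - S\<close> and \<open>z - S (2 W - 1)\<close> is
  \<open>(z^2 - 1) - 2 (z S - 1) W\<close>. The perturbation is \<open>F * K\<close>, so the
  determinant identity passes to size \<open>n\<close>, where \<open>K * F = 2 z K S L - 2\<close>
  because \<open>K * L = 1\<close>.\<close>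

lemma det_transfer:
  fixes S K L :: "'a :: idom mat"
  assumes S: "S \<in> carrier_mat m m" and K: "K \<in> carrier_mat n m" and L: "L \<in> carrier_mat m n"
    and SS: "S * S = 1\<^sub>m m" and KL: "K * L = 1\<^sub>m n"
  shows "(z\<^sup>2 - 1) ^ n * (det (z \<cdot>\<^sub>m 1\<^sub>m m - S) * det (z \<cdot>\<^sub>m 1\<^sub>m m - S * (2 \<cdot>\<^sub>m (L * K) - 1\<^sub>m m)))
       = (z\<^sup>2 - 1) ^ m * det ((z\<^sup>2 + 1) \<cdot>\<^sub>m 1\<^sub>m n - (2 * z) \<cdot>\<^sub>m (K * S * L))"
proof -
  define W where "W = L * K"
  define E where "E = z \<cdot>\<^sub>m S - 1\<^sub>m m"
  define F where "F = 2 \<cdot>\<^sub>m (E * L)"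
  have W: "W \<in> carrier_mat m m" and E: "E \<in> carrier_mat m m" and F: "F \<in> carrier_mat m n"
    and SW: "S * W \<in> carrier_mat m m" and KS: "K * S \<in> carrier_mat n m"
    using K L S by (auto simp: W_def E_def F_def)
  have SSW: "S * (S * W) = W"
    using S W SS by (simp flip: assoc_mult_mat[of S m m S m W m])
  have "S * (2 \<cdot>\<^sub>m W - 1\<^sub>m m) = 2 \<cdot>\<^sub>m (S * W) - S"
    using S W by (subst mult_minus_distrib_mat[of _ m m _ m]) (auto simp: mult_smult_distrib)
  moreover have "(z \<cdot>\<^sub>m 1\<^sub>m m - S) * X = z \<cdot>\<^sub>m X - S * X" if "X \<in> carrier_mat m m" for X
    using S that by (simp add: minus_mult_distrib_mat[of _ m m] mult_smult_assoc_mat[of _ m m])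
  moreover have "z \<cdot>\<^sub>m 1\<^sub>m m - (2 \<cdot>\<^sub>m (S * W) - S) \<in> carrier_mat m m"
    using S by (simp add: minus_carrier_mat)
  moreover have "S * (z \<cdot>\<^sub>m 1\<^sub>m m - (2 \<cdot>\<^sub>m (S * W) - S)) = z \<cdot>\<^sub>m S - (2 \<cdot>\<^sub>m W - 1\<^sub>m m)"
    using S SW
    by (simp add: mult_minus_distrib_mat[of _ m m _ m] mult_smult_distrib[of _ m m _ m] minus_carrier_mat SSW SS)
  ultimately have "(z \<cdot>\<^sub>m 1\<^sub>m m - S) * (z \<cdot>\<^sub>m 1\<^sub>m m - S * (2 \<cdot>\<^sub>m W - 1\<^sub>m m))
      = z \<cdot>\<^sub>m (z \<cdot>\<^sub>m 1\<^sub>m m - (2 \<cdot>\<^sub>m (S * W) - S)) - (z \<cdot>\<^sub>m S - (2 \<cdot>\<^sub>m W - 1\<^sub>m m))"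
    by simp
  also have "\<dots> = (z\<^sup>2 - 1) \<cdot>\<^sub>m 1\<^sub>m m - 2 \<cdot>\<^sub>m (z \<cdot>\<^sub>m (S * W) - W)"
    using S W SW by (intro eq_matI) (auto simp: algebra_simps power2_eq_square)
  also have "2 \<cdot>\<^sub>m (z \<cdot>\<^sub>m (S * W) - W) = F * K"
  proof -
    have "F * K = 2 \<cdot>\<^sub>m (E * W)"
      using E L K by (simp add: F_def W_def mult_smult_assoc_mat[of _ m n] assoc_mult_mat[of _ m m _ n _ m])
    also have "E * W = z \<cdot>\<^sub>m (S * W) - W"
      using S W by (simp add: E_def minus_mult_distrib_mat[of _ m m] mult_smult_assoc_mat[of _ m m])
    finally show ?thesis ..
  qed
  finally have prod: "(z \<cdot>\<^sub>m 1\<^sub>m m - S) * (z \<cdot>\<^sub>m 1\<^sub>m m - S * (2 \<cdot>\<^sub>m W - 1\<^sub>m m)) = (z\<^sup>2 - 1) \<cdot>\<^sub>m 1\<^sub>m m - F * K" .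
  have "K * F = 2 \<cdot>\<^sub>m (K * E * L)"
    using E L K by (simp add: F_def mult_smult_distrib[of K n m "E * L" n])
  also have "K * E * L = z \<cdot>\<^sub>m (K * S * L) - 1\<^sub>m n"
    using K S L KS
    by (simp add: E_def mult_minus_distrib_mat[of _ n m _ m] mult_smult_distrib[of _ n m _ m]
          minus_mult_distrib_mat[of _ n m] mult_smult_assoc_mat[of _ n m] KL)
  finally have "(z\<^sup>2 - 1) \<cdot>\<^sub>m 1\<^sub>m n - K * F = (z\<^sup>2 + 1) \<cdot>\<^sub>m 1\<^sub>m n - (2 * z) \<cdot>\<^sub>m (K * S * L)"
    using KS L by (intro eq_matI) (auto simp: algebra_simps)
  then show ?thesis
    using det_smult_one_minus_mult_comm[OF F K, of "z\<^sup>2 - 1"] S W SW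
    by (simp add: prod[symmetric] det_mult[of _ m] minus_carrier_mat flip: W_def)
qed

text \<open>Exchanging \<open>Q\<close> and \<open>R\<close> replaces \<open>(z - 1) + Q R\<close>
  by the scalar matrix \<open>(z - 1) + 2\<close>. For \<open>m = 2 * e\<close> and \<open>z\<close>
  different from 1, the result reads \<open>det (z - S) = (z^2 - 1)^e\<close>.\<close>

lemma det_reflection:
  fixes Q R :: "complex mat"
  assumes Q: "Q \<in> carrier_mat m e" and R: "R \<in> carrier_mat e m" and RQ: "R * Q = 2 \<cdot>\<^sub>m 1\<^sub>m e"
  shows "(z - 1) ^ e * det (z \<cdot>\<^sub>m 1\<^sub>m m - (1\<^sub>m m - Q * R)) = (z - 1) ^ m * (z + 1) ^ e"
proof -
  have "z \<cdot>\<^sub>m 1\<^sub>m m - (1\<^sub>m m - Q * R) = (z - 1) \<cdot>\<^sub>m 1\<^sub>m m - (- Q) * R"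
    using Q R by (intro eq_matI) (auto simp: algebra_simps)
  moreover have "(z - 1) \<cdot>\<^sub>m 1\<^sub>m e - R * (- Q) = (z + 1) \<cdot>\<^sub>m 1\<^sub>m e"
    using Q R by (intro eq_matI) (auto simp: RQ algebra_simps)
  ultimately show ?thesis
    using det_smult_one_minus_mult_comm[of "- Q" m e R "z - 1"] Q R by simp
qed

text \<open>\<open>R * Q = 2\<close> makes \<open>Q * R\<close> twice a projection, so
  \<open>1 - Q * R\<close> is a reflection.\<close>

lemma reflection_involution:
  fixes Q R :: "complex mat"
  assumes Q: "Q \<in> carrier_mat m e" and R: "R \<in> carrier_mat e m" and RQ: "R * Q = 2 \<cdot>\<^sub>m 1\<^sub>m e"
  shows "(1\<^sub>m m - Q * R) * (1\<^sub>m m - Q * R) = 1\<^sub>m m"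
proof -
  have QR: "Q * R \<in> carrier_mat m m" using Q R by simp
  have cancel: "1\<^sub>m m - X - (X - 2 \<cdot>\<^sub>m X) = 1\<^sub>m m" if "X \<in> carrier_mat m m" for X :: "complex mat"
    using that by (intro eq_matI) auto
  have "Q * R * (Q * R) = Q * (R * Q) * R"
    by (simp only: assoc_mult_mat[OF Q R QR] assoc_mult_mat[OF R Q R] assoc_mult_mat[OF Q mult_carrier_mat[OF R Q] R])
  also have "\<dots> = 2 \<cdot>\<^sub>m (Q * R)"
    using Q R by (simp add: RQ mult_smult_distrib[of _ m e _ e] mult_smult_assoc_mat[of _ m e _ m])
  finally have "Q * R * (Q * R) = 2 \<cdot>\<^sub>m (Q * R)" .
  then have "(1\<^sub>m m - Q * R) * (1\<^sub>m m - Q * R) = (1\<^sub>m m - Q * R) - (Q * R - 2 \<cdot>\<^sub>m (Q * R))"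
    using QR by (simp add: minus_mult_distrib_mat[of _ m m] mult_minus_distrib_mat[of _ m m _ m]
          left_mult_one_mat[of _ m m] right_mult_one_mat[of _ m m] minus_carrier_mat)
  also have "\<dots> = 1\<^sub>m m"
    by (rule cancel[OF QR])
  finally show ?thesis .
qed

text \<open>Here \<open>phi\<close> enters: after the factor \<open>2 * z\<close> is taken out, the
  characteristic polynomial of \<open>T\<close> is evaluated at \<open>w = phi z\<close>.\<close>

lemma det_quadratic_eq_prod_Spec:
  assumes T: "T \<in> carrier_mat n n" and z: "z \<noteq> 0"
  shows "det ((z\<^sup>2 + 1) \<cdot>\<^sub>m 1\<^sub>m n - (2 * z) \<cdot>\<^sub>m T) = (\<Prod>l\<in>#Spec T. z\<^sup>2 - 2 * l * z + 1)"
proof -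
  define w where "w = (z\<^sup>2 + 1) / (2 * z)"
  have "(z\<^sup>2 + 1) \<cdot>\<^sub>m 1\<^sub>m n - (2 * z) \<cdot>\<^sub>m T = (2 * z) \<cdot>\<^sub>m (w \<cdot>\<^sub>m 1\<^sub>m n - T)"
    using T z by (intro eq_matI) (auto simp: w_def field_simps)
  then have "det ((z\<^sup>2 + 1) \<cdot>\<^sub>m 1\<^sub>m n - (2 * z) \<cdot>\<^sub>m T) = (2 * z) ^ n * poly (char_poly T) w"
    using T by (simp add: poly_char_poly)
  also have "\<dots> = (2 * z) ^ size (Spec T) * (\<Prod>l\<in>#Spec T. w - l)"
    using char_poly_eq_prod_Spec[OF T] by (simp add: poly_prod_mset image_mset.compositionality o_def)
  also have "\<dots> = (\<Prod>l\<in>#Spec T. 2 * z * (w - l))"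
    by (simp add: prod_mset.distrib)
  also have "(\<lambda>l. 2 * z * (w - l)) = (\<lambda>l. z\<^sup>2 - 2 * l * z + 1)"
    using z by (auto simp: w_def field_simps)
  finally show ?thesis .
qed

text \<open>\<open>det_transfer\<close> gives the claim multiplied by
  \<open>det (z - S) = (z^2 - 1)^e\<close>, which can be cancelled unless \<open>z\<close> is 1 or
  -1; the formula for the spectrum of \<open>T\<close> needs \<open>z\<close> nonzero. Polynomials
  that agree off these three points are equal.\<close>

lemma char_poly_transfer:
  fixes K L Q R :: "complex mat" and e n :: nat
  defines "S \<equiv> 1\<^sub>m (2 * e) - Q * R"
  assumes Q: "Q \<in> carrier_mat (2 * e) e" and R: "R \<in> carrier_mat e (2 * e)"
    and K: "K \<in> carrier_mat n (2 * e)" and L: "L \<in> carrier_mat (2 * e) n"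
    and RQ: "R * Q = 2 \<cdot>\<^sub>m 1\<^sub>m e" and KL: "K * L = 1\<^sub>m n"
  shows "([:-1, 1:] * [:1, 1:]) ^ n * char_poly (S * (2 \<cdot>\<^sub>m (L * K) - 1\<^sub>m (2 * e)))
       = ([:-1, 1:] * [:1, 1:]) ^ e * (\<Prod>l\<in>#Spec (K * S * L). [:1, - 2 * l, 1:])" (is "?p = ?q")
proof -
  have S: "S \<in> carrier_mat (2 * e) (2 * e)"
    using Q R by (simp add: S_def minus_carrier_mat)
  have U: "S * (2 \<cdot>\<^sub>m (L * K) - 1\<^sub>m (2 * e)) \<in> carrier_mat (2 * e) (2 * e)"
    using S K L by (simp add: minus_carrier_mat)
  have T: "K * S * L \<in> carrier_mat n n"
    using S K L by simp
  have eq: "poly ?p z = poly ?q z" if "z \<notin> {0, 1, -1}" for z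
  proof -
    have z: "z - 1 \<noteq> 0" "z + 1 \<noteq> 0" "z \<noteq> 0"
      using that by (auto simp: add_eq_0_iff2)
    have fac: "z\<^sup>2 - 1 = (z - 1) * (z + 1)"
      by (simp add: algebra_simps power2_eq_square)
    have "(z - 1) ^ e * det (z \<cdot>\<^sub>m 1\<^sub>m (2 * e) - S) = (z - 1) ^ e * (z\<^sup>2 - 1) ^ e"
      using det_reflection[OF Q R RQ, of z]
      by (simp add: S_def fac power_mult_distrib mult_2 power_add)
    then have detS: "det (z \<cdot>\<^sub>m 1\<^sub>m (2 * e) - S) = (z\<^sup>2 - 1) ^ e"
      using z by simp
    have "S * S = 1\<^sub>m (2 * e)"
      unfolding S_def by (rule reflection_involution[OF Q R RQ])
    from det_transfer[OF S K L this KL, of z]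
    have "(z\<^sup>2 - 1) ^ e * ((z\<^sup>2 - 1) ^ n * poly (char_poly (S * (2 \<cdot>\<^sub>m (L * K) - 1\<^sub>m (2 * e)))) z)
      = (z\<^sup>2 - 1) ^ e * ((z\<^sup>2 - 1) ^ e * (\<Prod>l\<in>#Spec (K * S * L). z\<^sup>2 - 2 * l * z + 1))"
      unfolding detS det_quadratic_eq_prod_Spec[OF T z(3)] poly_char_poly[OF U]
      by (simp only: mult_2 power_add mult.assoc mult.left_commute)
    then have "(z\<^sup>2 - 1) ^ n * poly (char_poly (S * (2 \<cdot>\<^sub>m (L * K) - 1\<^sub>m (2 * e)))) z
      = (z\<^sup>2 - 1) ^ e * (\<Prod>l\<in>#Spec (K * S * L). z\<^sup>2 - 2 * l * z + 1)"
      using z by (simp add: fac)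
    then show ?thesis
      by (simp add: poly_power poly_prod_mset image_mset.compositionality o_def fac
            algebra_simps power2_eq_square)
  qed
  show ?thesis
  proof (rule ccontr)
    assume "?p \<noteq> ?q"
    then have "finite {z. poly (?p - ?q) z = 0}"
      by (intro poly_roots_finite) simp
    moreover have "- {0, 1, -1} \<subseteq> {z. poly (?p - ?q) z = 0}"
      using eq by (auto simp del: poly_mult)
    ultimately have "finite (- {0, 1, -1 :: complex})"
      by (rule rev_finite_subset)
    then show False
      using infinite_UNIV_char_0[where ?'a = complex] by (simp add: Compl_eq_Diff_UNIV)
  qed
qed

section \<open>Roots of \<open>z^2 - 2 l z + 1\<close> and the fibres of \<open>phi\<close>\<close>

text \<open>The roots are \<open>cis t\<close> and \<open>cis (- t)\<close> with
  \<open>cos t = l\<close>. For \<open>l = 1\<close> and \<open>l = -1\<close> they coincide: the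
  polynomial has a double root where the fibre has a single point. The correction terms supply the
  second copy, and they are the source of the multiplicities of 1 and -1 in the final
  formula.\<close>

lemma phi_fibre_proots:
  assumes "l \<in> \<real>" "-1 \<le> Re l" "Re l \<le> 1"
  shows "proots [:1, - 2 * l, 1:] = phi_fibre l + (if l = 1 then {#1#} else {#}) + (if l = -1 then {#-1#} else {#})"
proof -
  obtain x where l: "l = of_real x"
    using assms(1) by (auto elim: Reals_cases)
  define t where "t = arccos x"
  have t: "cos t = x"
    using assms by (simp add: t_def l)
  have "[:1, - 2 * l, 1:] = [:- cis t, 1:] * [:- cis (- t), 1:]"
    using t by (simp add: l complex_eq_iff cis_mult del: cis_cnj)
  then have *: "proots [:1, - 2 * l, 1:] = {#cis t, cis (- t)#}"
    by (simp add: proots_mult del: cis_cnj mult_pCons_left mult_pCons_right)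
  consider "x = 1" | "x = -1" | "-1 < x" "x < 1"
    using assms l by force
  then show ?thesis
  proof cases
    case 3
    then show ?thesis
      unfolding * by (auto simp: l phi_fibre_def t_def complex_eq_iff)
  qed (unfold *, auto simp: l t_def phi_fibre_def complex_eq_iff)
qed

lemma sum_mset_if_single:
  "(\<Sum>x\<in>#M. if x = a then {#a#} else {#}) = replicate_mset (count M a) a"
  by (induction M) auto

lemma phi_preimage_proots:
  assumes "\<And>l. l \<in># \<Lambda> \<Longrightarrow> l \<in> \<real> \<and> -1 \<le> Re l \<and> Re l \<le> 1"
  shows "proots (\<Prod>l\<in>#\<Lambda>. [:1, - 2 * l, 1:])
       = phi_preimage \<Lambda> + replicate_mset (count \<Lambda> 1) 1 + replicate_mset (count \<Lambda> (-1)) (-1)"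
proof -
  have "proots (\<Prod>l\<in>#\<Lambda>. [:1, - 2 * l, 1:]) = (\<Sum>l\<in>#\<Lambda>. proots [:1, - 2 * l, 1:])"
    using proots_prod_mset[of "image_mset (\<lambda>l. [:1, - 2 * l, 1:]) \<Lambda>"]
    by (simp add: image_mset.compositionality o_def image_iff)
  also have "\<dots> = (\<Sum>l\<in>#\<Lambda>. phi_fibre l + (if l = 1 then {#1#} else {#}) + (if l = -1 then {#-1#} else {#}))"
    using assms by (intro arg_cong[of _ _ sum_mset] image_mset_cong phi_fibre_proots) auto
  also have "\<dots> = phi_preimage \<Lambda> + replicate_mset (count \<Lambda> 1) 1 + replicate_mset (count \<Lambda> (-1)) (-1)"
    by (simp add: sum_mset.distrib phi_preimage_def sum_mset_if_single)
  finally show ?thesis .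
qed

section \<open>Multiplicities, and the spectrum of an abstract transfer matrix\<close>

text \<open>This is a rank bound: \<open>A * B\<close> factors through dimension \<open>e\<close>.
  Exchanging the factors trades \<open>e\<close> copies of \<open>c\<close> on the side of
  \<open>A * B\<close> for \<open>n\<close> copies on the side of \<open>B * A\<close>.\<close>

lemma count_Spec_shift_ge:
  assumes A: "A \<in> carrier_mat n e" and B: "B \<in> carrier_mat e n"
  shows "n \<le> e + count (Spec (c \<cdot>\<^sub>m 1\<^sub>m n + A * B)) c"
proof -
  have "n \<le> count (replicate_mset n c + Spec (c \<cdot>\<^sub>m 1\<^sub>m e + B * A)) c" by simp
  also have "\<dots> = e + count (Spec (c \<cdot>\<^sub>m 1\<^sub>m n + A * B)) c"
    by (simp flip: Spec_shift_mult_comm[OF A B])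
  finally show ?thesis .
qed

lemma Spec_eigenvalue:
  assumes "A \<in> carrier_mat n n"
  shows "l \<in># Spec A \<longleftrightarrow> eigenvalue A l"
  using char_poly_nonzero[OF assms] by (simp add: Spec_def eigenvalue_root_char_poly[OF assms])

lemma eigenvalue_shift:
  fixes c d l :: complex
  assumes A: "A \<in> carrier_mat n n" and "eigenvalue (c \<cdot>\<^sub>m 1\<^sub>m n + d \<cdot>\<^sub>m A) l" and "d \<noteq> 0"
  shows "eigenvalue A ((l - c) / d)"
proof -
  obtain v where v: "v \<in> carrier_vec n" "v \<noteq> 0\<^sub>v n" "(c \<cdot>\<^sub>m 1\<^sub>m n + d \<cdot>\<^sub>m A) *\<^sub>v v = l \<cdot>\<^sub>v v"
    using assms unfolding eigenvalue_def eigenvector_def by auto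
  have "(c \<cdot>\<^sub>m 1\<^sub>m n + d \<cdot>\<^sub>m A) *\<^sub>v v = c \<cdot>\<^sub>v v + d \<cdot>\<^sub>v (A *\<^sub>v v)"
    using A v(1) by (intro eq_vecI) (auto simp: add_scalar_prod_distrib[of _ n])
  with v(3) have eq: "c \<cdot>\<^sub>v v + d \<cdot>\<^sub>v (A *\<^sub>v v) = l \<cdot>\<^sub>v v" by simp
  have "A *\<^sub>v v = ((l - c) / d) \<cdot>\<^sub>v v"
  proof (rule eq_vecI)
    fix i assume i: "i < dim_vec (((l - c) / d) \<cdot>\<^sub>v v)"
    have "(c \<cdot>\<^sub>v v + d \<cdot>\<^sub>v (A *\<^sub>v v)) $ i = (l \<cdot>\<^sub>v v) $ i" by (simp only: eq)
    then show "(A *\<^sub>v v) $ i = (((l - c) / d) \<cdot>\<^sub>v v) $ i"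
      using i A v \<open>d \<noteq> 0\<close> by (simp add: field_simps)
  qed (use A v in auto)
  then show ?thesis
    using A v unfolding eigenvalue_def eigenvector_def by auto
qed

lemma mat_adjoint_mult:
  fixes A B :: "complex mat"
  assumes "A \<in> carrier_mat n m" "B \<in> carrier_mat m k"
  shows "mat_adjoint (A * B) = mat_adjoint B * mat_adjoint A"
  using assms by (intro eq_matI) (auto simp: mat_adjoint_eq scalar_prod_def mult.commute)

text \<open>The theorem with the graph removed: it enters only through a coisometry \<open>K\<close>
  and the two factorizations of \<open>S\<close>. Both are needed, since \<open>P\<close> controls
  the eigenvalue -1 of \<open>T\<close> and the lower bound, \<open>Q\<close> the eigenvalue 1 and
  the upper bound.\<close>

lemma Spec_transfer:
  fixes K P Q S :: "complex mat" and e n :: nat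
  defines "T \<equiv> K * S * mat_adjoint K"
  defines "M \<equiv> \<lambda>c. nat (max 0 (int e - int n + int (count (Spec T) c)))"
  assumes K: "K \<in> carrier_mat n (2 * e)" and P: "P \<in> carrier_mat (2 * e) e" and Q: "Q \<in> carrier_mat (2 * e) e"
    and KK: "K * mat_adjoint K = 1\<^sub>m n"
    and SP: "S = P * mat_adjoint P - 1\<^sub>m (2 * e)"
    and SQ: "S = 1\<^sub>m (2 * e) - Q * mat_adjoint Q"
    and QQ: "mat_adjoint Q * Q = 2 \<cdot>\<^sub>m 1\<^sub>m e"
  shows "Spec (S * (2 \<cdot>\<^sub>m (mat_adjoint K * K) - 1\<^sub>m (2 * e)))
       = phi_preimage (Spec T) + replicate_mset (M 1) 1 + replicate_mset (M (-1)) (-1)"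
proof -
  define U where "U = S * (2 \<cdot>\<^sub>m (mat_adjoint K * K) - 1\<^sub>m (2 * e))"
  have S: "S \<in> carrier_mat (2 * e) (2 * e)"
    using Q by (simp add: SQ minus_carrier_mat)
  have U: "U \<in> carrier_mat (2 * e) (2 * e)"
    using S K by (simp add: U_def minus_carrier_mat)
  have T: "T \<in> carrier_mat n n"
    unfolding T_def using S K mat_adjoint_carrier[OF K] by (metis mult_carrier_mat)
  have KPQ: "K * P \<in> carrier_mat n e" "K * Q \<in> carrier_mat n e"
    using K P Q by auto
  have sandwich: "K * (X * mat_adjoint X) * mat_adjoint K = K * X * mat_adjoint (K * X)"
    if X: "X \<in> carrier_mat (2 * e) e" for X
  proof -
    note X' = mat_adjoint_carrier[OF X] and K' = mat_adjoint_carrier[OF K]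
    have "K * (X * mat_adjoint X) * mat_adjoint K = K * X * mat_adjoint X * mat_adjoint K"
      by (simp only: assoc_mult_mat[OF K X X'])
    also have "\<dots> = K * X * (mat_adjoint X * mat_adjoint K)"
      using K X X' K' by (intro assoc_mult_mat[of _ n e _ "2 * e" _ n]) auto
    finally show ?thesis
      by (simp only: mat_adjoint_mult[OF K X])
  qed
  have TP: "T = (-1) \<cdot>\<^sub>m 1\<^sub>m n + 1 \<cdot>\<^sub>m (K * P * mat_adjoint (K * P))"
  proof -
    have "T = (K * (P * mat_adjoint P) - K) * mat_adjoint K"
      using K P by (simp add: T_def SP mult_minus_distrib_mat[of K n "2 * e" _ "2 * e"])
    also have "\<dots> = K * P * mat_adjoint (K * P) - 1\<^sub>m n"
      using K P by (simp add: minus_mult_distrib_mat[of _ n "2 * e" _ _ n] KK sandwich)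
    also have "\<dots> = (-1) \<cdot>\<^sub>m 1\<^sub>m n + 1 \<cdot>\<^sub>m (K * P * mat_adjoint (K * P))"
      using K by (intro eq_matI) auto
    finally show ?thesis .
  qed
  have TQ: "T = 1 \<cdot>\<^sub>m 1\<^sub>m n + (-1) \<cdot>\<^sub>m (K * Q * mat_adjoint (K * Q))"
  proof -
    have "T = (K - K * (Q * mat_adjoint Q)) * mat_adjoint K"
      using K Q by (simp add: T_def SQ mult_minus_distrib_mat[of K n "2 * e" _ "2 * e"])
    also have "\<dots> = 1\<^sub>m n - K * Q * mat_adjoint (K * Q)"
      using K Q by (simp add: minus_mult_distrib_mat[of _ n "2 * e" _ _ n] KK sandwich)
    also have "\<dots> = 1 \<cdot>\<^sub>m 1\<^sub>m n + (-1) \<cdot>\<^sub>m (K * Q * mat_adjoint (K * Q))"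
      using K by (intro eq_matI) auto
    finally show ?thesis .
  qed
  have bounds: "l \<in> \<real> \<and> -1 \<le> Re l \<and> Re l \<le> 1" if "l \<in># Spec T" for l
  proof -
    have l: "eigenvalue T l"
      using that Spec_eigenvalue[OF T] by simp
    \<comment> \<open>The quotients have the shape produced by \<open>eigenvalue_shift\<close>; they
      are \<open>l + 1\<close> and \<open>1 - l\<close>. Nonnegativity in the complex order includes
      vanishing imaginary part.\<close>
    have "(l - (-1)) / 1 \<ge> 0"
      using KPQ(1) l
      by (intro eigenvalue_mult_adjoint_nonneg[OF KPQ(1)] eigenvalue_shift[of _ n])
         (auto simp flip: TP)
    moreover have "(l - 1) / (-1) \<ge> 0"
      using KPQ(2) l
      by (intro eigenvalue_mult_adjoint_nonneg[OF KPQ(2)] eigenvalue_shift[of _ n])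
         (auto simp flip: TQ)
    ultimately show ?thesis
      by (auto simp: less_eq_complex_def complex_is_Real_iff)
  qed
  \<comment> \<open>\<open>m1\<close> and \<open>m2\<close> show that the maximum with 0 in
    \<open>M\<close> never truncates.\<close>
  have m1: "n \<le> e + count (Spec T) 1"
  proof -
    have "T = 1 \<cdot>\<^sub>m 1\<^sub>m n + ((-1) \<cdot>\<^sub>m (K * Q)) * mat_adjoint (K * Q)"
      using KPQ(2) TQ by (simp add: mult_smult_assoc_mat[of _ n e _ n])
    then show ?thesis
      using count_Spec_shift_ge[of "(-1) \<cdot>\<^sub>m (K * Q)" n e "mat_adjoint (K * Q)" 1] KPQ(2) by simp
  qed
  have m2: "n \<le> e + count (Spec T) (-1)"
  proof -
    have "T = (-1) \<cdot>\<^sub>m 1\<^sub>m n + (1 \<cdot>\<^sub>m (K * P)) * mat_adjoint (K * P)"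
      using KPQ(1) TP by (simp add: mult_smult_assoc_mat[of _ n e _ n])
    then show ?thesis
      using count_Spec_shift_ge[of "1 \<cdot>\<^sub>m (K * P)" n e "mat_adjoint (K * P)" "-1"] KPQ(1) by simp
  qed
  have nz: "char_poly U \<noteq> 0" "(\<Prod>l\<in>#Spec T. [:1, - 2 * l, 1:]) \<noteq> 0"
    using char_poly_nonzero[OF U] by auto
  define p :: "complex poly" where "p = [:-1, 1:] * [:1, 1:]"
  have p: "p \<noteq> 0" "proots (p ^ k) = replicate_mset k 1 + replicate_mset k (-1)" for k
    unfolding p_def proots_power by (simp, subst proots_mult) (auto intro!: multiset_eqI)
  have "p ^ n * char_poly U = p ^ e * (\<Prod>l\<in>#Spec T. [:1, - 2 * l, 1:])"
    using char_poly_transfer[OF Q mat_adjoint_carrier[OF Q] K mat_adjoint_carrier[OF K] QQ KK]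
    by (simp only: U_def T_def p_def flip: SQ)
  then have "proots (p ^ n) + Spec U = proots (p ^ e) + proots (\<Prod>l\<in>#Spec T. [:1, - 2 * l, 1:])"
    unfolding Spec_def[of U] using nz p(1) by (metis power_not_zero proots_mult)
  then have "replicate_mset n 1 + replicate_mset n (-1) + Spec U
      = replicate_mset e 1 + replicate_mset e (-1) + phi_preimage (Spec T)
        + replicate_mset (count (Spec T) 1) 1 + replicate_mset (count (Spec T) (-1)) (-1)"
    using phi_preimage_proots[of "Spec T"] bounds by (simp add: p(2) ac_simps)
  \<comment> \<open>Since \<open>n\<close> may exceed \<open>e\<close> (for a tree,
    \<open>n = e + 1\<close>), the copies of 1 and -1 on the left need not cancel against the
    \<open>e\<close> copies on the right alone. Multiplicities are therefore compared point by
    point, using \<open>m1\<close> and \<open>m2\<close>.\<close>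
  then have eq: "count (replicate_mset n 1 + replicate_mset n (-1) + Spec U) x
      = count (replicate_mset e 1 + replicate_mset e (-1) + phi_preimage (Spec T)
        + replicate_mset (count (Spec T) 1) 1 + replicate_mset (count (Spec T) (-1)) (-1)) x" for x
    by simp
  have "M 1 + n = e + count (Spec T) 1" "M (-1) + n = e + count (Spec T) (-1)"
    using m1 m2 by (auto simp: M_def)
  then show ?thesis
    unfolding U_def[symmetric]
  proof (intro multiset_eqI)
    fix x
    show "count (Spec U) x = count (phi_preimage (Spec T) + replicate_mset (M 1) 1 + replicate_mset (M (-1)) (-1)) x"
      using eq[of x] \<open>M 1 + n = _\<close> \<open>M (-1) + n = _\<close> by (auto split: if_splits)
  qed
qed

section \<open>Matrices indexed by enumerated sets\<close>

lemma mat_on_carrier [simp]: "mat_on rs cs f \<in> carrier_mat (length rs) (length cs)"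
  by (simp add: mat_on_def)

lemma mat_on_cong:
  assumes "\<And>r c. r \<in> set rs \<Longrightarrow> c \<in> set cs \<Longrightarrow> f r c = g r c"
  shows "mat_on rs cs f = mat_on rs cs g"
  using assms by (auto simp: mat_on_def intro!: cong_mat)

text \<open>Distinctness of the middle enumeration turns the sum over positions into a sum over the
  index set, so that later products are computed without list positions.\<close>

lemma mat_on_mult:
  assumes "distinct cs"
  shows "mat_on rs cs f * mat_on cs ds g = mat_on rs ds (\<lambda>r d. \<Sum>c\<in>set cs. f r c * g c d)"
proof -
  have "(\<Sum>k = 0..<length cs. h (cs ! k)) = (\<Sum>c\<in>set cs. h c)" for h
    using sum.reindex_bij_betw[OF bij_betw_nth[OF assms refl refl], of h]
    by (simp add: atLeast0LessThan)
  then show ?thesis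
    by (intro eq_matI) (auto simp: mat_on_def scalar_prod_def)
qed

lemma mat_adjoint_mat_on: "mat_adjoint (mat_on rs cs f) = mat_on cs rs (\<lambda>c r. cnj (f r c))"
  by (intro eq_matI) (auto simp: mat_on_def mat_adjoint_eq)

lemma one_mat_on:
  assumes "distinct rs"
  shows "1\<^sub>m (length rs) = mat_on rs rs (\<lambda>r c. if r = c then 1 else 0)"
  using assms by (intro eq_matI) (auto simp: mat_on_def nth_eq_iff_index_eq)

lemma minus_mat_on: "mat_on rs cs f - mat_on rs cs g = mat_on rs cs (\<lambda>r c. f r c - g r c)"
  by (intro eq_matI) (auto simp: mat_on_def)

lemma smult_mat_on: "k \<cdot>\<^sub>m mat_on rs cs f = mat_on rs cs (\<lambda>r c. k * f r c)"
  by (intro eq_matI) (auto simp: mat_on_def)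

section \<open>Arcs, edges, degrees and orientations\<close>

lemma swap_sym_arcs [simp]: "prod.swap a \<in> sym_arcs G \<longleftrightarrow> a \<in> sym_arcs G"
  by (cases a) (auto simp: sym_arcs_def)

text \<open>Reversing an arc negates its phase; this makes \<open>S\<close> Hermitian.\<close>

lemma cis_eta_fun_swap: "cis (eta_fun G \<eta> (prod.swap a)) = cnj (cis (eta_fun G \<eta> a))"
  by (cases a) (auto simp: eta_fun_def cis_cnj)

lemma arc_eq_or_swap: "{fst a, snd a} = {fst b, snd b} \<Longrightarrow> a = b \<or> a = prod.swap b"
  by (cases a; cases b) (auto simp: doubleton_eq_iff)

lemma sym_edges_eq: "sym_edges G = (\<lambda>a. {fst a, snd a}) ` sym_arcs G"
  by (force simp: sym_edges_def)

context pair_digraph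
begin

lemma sym_arcs_irrefl: "a \<in> sym_arcs G \<Longrightarrow> fst a \<noteq> snd a"
  using pair_no_loops by (force simp: sym_arcs_def)

lemma swap_neq: "a \<in> sym_arcs G \<Longrightarrow> prod.swap a \<noteq> a"
  using sym_arcs_irrefl[of a] by (cases a) auto

lemma finite_sym_arcs: "finite (sym_arcs G)"
  using pair_finite_arcs by (simp add: sym_arcs_def)

text \<open>Every edge at \<open>x\<close> has exactly one arc that ends in \<open>x\<close>. Such
  arcs are the support of the row of \<open>K\<close> at \<open>x\<close>.\<close>

lemma deg_eq_card_in_arcs: "deg G x = card {a \<in> sym_arcs G. snd a = x}"
proof -
  have "bij_betw (\<lambda>a. {fst a, snd a}) {a \<in> sym_arcs G. snd a = x} {e \<in> sym_edges G. x \<in> e}"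
  proof (rule bij_betwI')
    fix a b assume "a \<in> {a \<in> sym_arcs G. snd a = x}" "b \<in> {a \<in> sym_arcs G. snd a = x}"
    then show "({fst a, snd a} = {fst b, snd b}) = (a = b)"
      by (cases a; cases b) (auto simp: doubleton_eq_iff)
  next
    fix e assume "e \<in> {e \<in> sym_edges G. x \<in> e}"
    then obtain a where a: "a \<in> sym_arcs G" "e = {fst a, snd a}" "x \<in> e"
      by (auto simp: sym_edges_eq)
    show "\<exists>a\<in>{a \<in> sym_arcs G. snd a = x}. e = {fst a, snd a}"
    proof (cases "snd a = x")
      case False
      with a have "prod.swap a \<in> sym_arcs G \<and> snd (prod.swap a) = x \<and> e = {fst (prod.swap a), snd (prod.swap a)}"
        by auto
      then show ?thesis by blast
    qed (use a in blast)
  qed (auto simp: sym_edges_eq)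
  then show ?thesis
    by (simp add: deg_def bij_betw_same_card)
qed

text \<open>The ends of an arc are distinct, so some vertex \<open>y\<close> differs from
  \<open>x\<close>; the last step of a walk from \<open>y\<close> to \<open>x\<close> is an arc into
  \<open>x\<close>.\<close>

lemma deg_pos:
  assumes "Digraph_Component.connected (with_proj G)" "parcs G \<noteq> {}" "x \<in> pverts G"
  shows "deg G x > 0"
proof -
  obtain u v where uv: "(u, v) \<in> parcs G" using assms(2) by auto
  then have "u \<in> pverts G" "v \<in> pverts G" "u \<noteq> v"
    using in_arcsD1 in_arcsD2 pair_no_loops by fastforce+
  then obtain y where y: "y \<in> pverts G" "y \<noteq> x" by metis
  have "(y, x) \<in> rtrancl_on (pverts G) ((parcs G)\<^sup>s)"
    using assms(1,3) y by (simp add: connected_conv)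
  then have "(y, x) \<in> (sym_arcs G)\<^sup>*"
    by (induction rule: rtrancl_on_induct)
       (auto simp: sym_arcs_def symcl_def intro: rtrancl_into_rtrancl)
  with y obtain z where "(z, x) \<in> sym_arcs G"
    by (meson rtranclE)
  then have "{a \<in> sym_arcs G. snd a = x} \<noteq> {}" by auto
  then show ?thesis
    using finite_sym_arcs by (auto simp: deg_eq_card_in_arcs card_gt_0_iff)
qed

text \<open>The list \<open>os\<close> will index the columns of \<open>P\<close> and
  \<open>Q\<close>. It consists of one chosen arc per edge; the map from arcs to edges is a left
  inverse of the choice, which gives the length.\<close>

lemma orientation_exists:
  obtains os where "distinct os" "length os = card (sym_edges G)"
    "set os \<subseteq> sym_arcs G"
    "\<And>a. a \<in> sym_arcs G \<Longrightarrow> a \<in> set os \<longleftrightarrow> prod.swap a \<notin> set os"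
proof -
  define f where "f = (\<lambda>e. SOME a. a \<in> sym_arcs G \<and> {fst a, snd a} = e)"
  have f: "f e \<in> sym_arcs G \<and> {fst (f e), snd (f e)} = e" if "e \<in> sym_edges G" for e
    unfolding f_def by (rule someI_ex) (use that in \<open>unfold sym_edges_eq, blast\<close>)
  have inj: "inj_on f (sym_edges G)"
    by (rule inj_on_inverseI[where g = "\<lambda>a. {fst a, snd a}"]) (use f in blast)
  have "finite (f ` sym_edges G)"
    using finite_sym_arcs by (simp add: sym_edges_eq)
  then obtain os where os: "set os = f ` sym_edges G" "distinct os"
    using finite_distinct_list by blast
  show thesis
  proof
    show "length os = card (sym_edges G)"
      using os inj by (metis card_image distinct_card)
    show "set os \<subseteq> sym_arcs G" using os f by auto
    fix a assume a: "a \<in> sym_arcs G"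
    then have e: "{fst a, snd a} \<in> sym_edges G" by (auto simp: sym_edges_eq)
    \<comment> \<open>An arc and its reversal lie on the same edge, so this criterion selects
      exactly one of them; they are distinct because there are no loops.\<close>
    have mem: "b \<in> set os \<longleftrightarrow> f {fst b, snd b} = b" if "b \<in> sym_arcs G" for b
    proof
      assume "b \<in> set os"
      then obtain e where "e \<in> sym_edges G" "b = f e" using os(1) by auto
      then show "f {fst b, snd b} = b" using f[of e] by auto
    next
      assume "f {fst b, snd b} = b"
      moreover have "{fst b, snd b} \<in> sym_edges G" using that by (auto simp: sym_edges_eq)
      ultimately show "b \<in> set os" using os(1) by (metis imageI)
    qed
    have "f {fst a, snd a} = a \<or> f {fst a, snd a} = prod.swap a"
      using f[OF e] by (intro arc_eq_or_swap) simp
    moreover have "{fst (prod.swap a), snd (prod.swap a)} = {fst a, snd a}"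
      by auto
    ultimately show "a \<in> set os \<longleftrightarrow> prod.swap a \<notin> set os"
      using mem[OF a] mem[of "prod.swap a"] a swap_neq[OF a] by auto
  qed (use os in auto)
qed

text \<open>An orientation and its reversal partition the arcs.\<close>

lemma card_sym_arcs: "card (sym_arcs G) = 2 * card (sym_edges G)"
proof -
  obtain os where os: "distinct os" "length os = card (sym_edges G)" "set os \<subseteq> sym_arcs G"
    "\<And>a. a \<in> sym_arcs G \<Longrightarrow> a \<in> set os \<longleftrightarrow> prod.swap a \<notin> set os"
    using orientation_exists by blast
  have swapI: "a \<in> prod.swap ` set os" if "prod.swap a \<in> set os" for a :: "'a \<times> 'a"
    using that by (metis imageI swap_swap)
  then have "sym_arcs G = set os \<union> prod.swap ` set os"
  proof (intro equalityI subsetI)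
    fix a assume "a \<in> set os \<union> prod.swap ` set os"
    then show "a \<in> sym_arcs G"
      using os(3) swap_sym_arcs[of _ G] by blast
  next
    fix a assume "a \<in> sym_arcs G"
    then show "a \<in> set os \<union> prod.swap ` set os"
      using os(4)[of a] swapI[of a] by blast
  qed
  moreover have "set os \<inter> prod.swap ` set os = {}"
  proof -
    have "prod.swap a \<notin> set os" if "a \<in> set os" for a
      using that os(3) os(4)[of a] by blast
    then show ?thesis by blast
  qed
  ultimately have "card (sym_arcs G) = card (set os) + card (prod.swap ` set os)"
    by (simp add: card_Un_disjoint)
  also have "card (prod.swap ` set os) = card (set os)"
    by (intro card_image) (auto simp: inj_on_def)
  finally show ?thesis
    using os by (simp add: distinct_card)
qed

end

section \<open>The two factorizations of \<open>S\<close>\<close>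

text \<open>The column of a chosen arc \<open>b\<close> is the unit vector at \<open>b\<close> plus
  \<open>c * u b\<close> times the unit vector at its reversal. If \<open>u\<close> is the phase of
  the arcs, this is an eigenvector of \<open>S\<close> for the eigenvalue \<open>c\<close>, where
  \<open>c\<close> is 1 or -1. Thus \<open>c = 1\<close> yields \<open>P\<close> and
  \<open>c = -1\<close> yields \<open>Q\<close>.\<close>

definition half_arc_mat ::
  "('a \<times> 'a \<Rightarrow> complex) \<Rightarrow> complex \<Rightarrow> ('a \<times> 'a) list \<Rightarrow> ('a \<times> 'a) list \<Rightarrow> complex mat" where
  "half_arc_mat u c as os =
     mat_on as os (\<lambda>a b. (if a = b then 1 else 0) + c * (if a = prod.swap b then u b else 0))"

context pair_digraph
begin

context
  fixes u :: "'a \<times> 'a \<Rightarrow> complex" and c :: complex and as os :: "('a \<times> 'a) list"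
  assumes u: "\<And>a. u (prod.swap a) = cnj (u a)" "\<And>a. u a * cnj (u a) = 1"
    and c: "c = 1 \<or> c = -1"
    and as: "distinct as" "set as = sym_arcs G"
    and os: "distinct os" "set os \<subseteq> sym_arcs G"
      "\<And>a. a \<in> sym_arcs G \<Longrightarrow> a \<in> set os \<longleftrightarrow> prod.swap a \<notin> set os"
begin

text \<open>The right-hand side is \<open>1 + c S\<close>. Each row has a single nonzero entry, in
  the column of the edge of its arc, so the sum collapses to one term.\<close>

lemma half_arc_mat_mult_adjoint:
  "half_arc_mat u c as os * mat_adjoint (half_arc_mat u c as os)
   = mat_on as as (\<lambda>a b. (if a = b then 1 else 0) + c * (if a = prod.swap b then u b else 0))"
  unfolding half_arc_mat_def mat_adjoint_mat_on mat_on_mult[OF os(1)]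
proof (rule mat_on_cong)
  fix a b assume "a \<in> set as" "b \<in> set as"
  then have a: "a \<in> sym_arcs G" and b: "b \<in> sym_arcs G" using as by auto
  define g where "g = (\<lambda>a b. (if a = b then 1 else 0) + c * (if a = prod.swap b then u b else 0))"
  \<comment> \<open>\<open>o'\<close> is the chosen arc on the edge of \<open>a\<close>.\<close>
  obtain o' where o': "o' \<in> set os" "a = o' \<or> a = prod.swap o'"
    using os(3)[OF a] by (metis swap_swap)
  have "g a x = 0" if "x \<in> set os - {o'}" for x
    using that o' os(2) os(3)[of x] by (auto simp: g_def inj_eq[OF inj_swap])
  then have "(\<Sum>x\<in>set os. g a x * cnj (g b x)) = g a o' * cnj (g b o')"
    using o' by (subst sum.mono_neutral_right[of _ "{o'}"]) auto
  also have "\<dots> = g a b"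
  proof -
    have sw: "prod.swap o' \<noteq> o'" using o' os(2) swap_neq by blast
    have cc: "cnj c = c" "c * c = 1" "c * (c * x) = x" for x using c by auto
    have eq: "prod.swap o' = b \<longleftrightarrow> b = prod.swap o'" "o' = prod.swap b \<longleftrightarrow> b = prod.swap o'"
      by auto
    consider "b = o'" | "b = prod.swap o'" | "b \<noteq> o'" "b \<noteq> prod.swap o'" by blast
    then show ?thesis
      using o'(2) sw by cases (auto simp: g_def u cc eq inj_eq[OF inj_swap] mult.assoc mult.left_commute[of _ c])
  qed
  finally show "(\<Sum>x\<in>set os. ((if a = x then 1 else 0) + c * (if a = prod.swap x then u x else 0))
        * cnj ((if b = x then 1 else 0) + c * (if b = prod.swap x then u x else 0)))
      = (if a = b then 1 else 0) + c * (if a = prod.swap b then u b else 0)"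
    by (simp only: g_def)
qed

text \<open>Columns of different edges have disjoint supports, and each column has two entries of
  modulus 1.\<close>

lemma adjoint_mult_half_arc_mat:
  "mat_adjoint (half_arc_mat u c as os) * half_arc_mat u c as os = 2 \<cdot>\<^sub>m 1\<^sub>m (length os)"
  unfolding half_arc_mat_def mat_adjoint_mat_on mat_on_mult[OF as(1)] one_mat_on[OF os(1)] smult_mat_on
proof (rule mat_on_cong)
  fix a b assume a: "a \<in> set os" and b: "b \<in> set os"
  define g where "g = (\<lambda>a b. (if a = b then 1 else 0) + c * (if a = prod.swap b then u b else 0))"
  have sw: "prod.swap a \<noteq> a" "a \<noteq> prod.swap b"
    using a b os(2) os(3)[of b] swap_neq[of a] by blast+
  have "(\<Sum>x\<in>set as. cnj (g x a) * g x b) = (\<Sum>x\<in>{a, prod.swap a}. cnj (g x a) * g x b)"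
    using a os(2) as(2) finite_sym_arcs by (intro sum.mono_neutral_right) (auto simp: g_def)
  also have "\<dots> = 2 * (if a = b then 1 else 0)"
  proof -
    have cc: "cnj c = c" "c * c = 1" using c by auto
    have "cnj (c * u b) * (c * u b) = c * c * (u b * cnj (u b))"
      by (simp add: cc(1))
    also have "\<dots> = 1"
      by (simp only: cc(2) u(2) mult_1)
    finally have "cnj (c * u b) * (c * u b) = 1" .
    moreover have "g a b = (if a = b then 1 else 0)" "g (prod.swap a) b = (if a = b then c * u b else 0)"
      using sw by (auto simp: g_def inj_eq[OF inj_swap] simp del: swap_simp)
    ultimately show ?thesis
      using sw(1) by (cases "a = b") (simp_all del: complex_cnj_mult)
  qed
  finally show "(\<Sum>x\<in>set as. cnj ((if x = a then 1 else 0) + c * (if x = prod.swap a then u a else 0))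
        * ((if x = b then 1 else 0) + c * (if x = prod.swap b then u b else 0)))
      = 2 * (if a = b then 1 else 0)"
    by (simp only: g_def)
qed

end

section \<open>The matrix \<open>K\<close> and the normalised Hermitian adjacency matrix\<close>

text \<open>Rows of different vertices have disjoint supports, since an arc has one end. The row of
  \<open>v\<close> has \<open>deg G v\<close> entries of square \<open>1 / deg G v\<close>, which
  requires a positive degree.\<close>

lemma K_mat_mult_adjoint:
  assumes "distinct vs" "distinct as" "set as = sym_arcs G" "\<And>v. v \<in> set vs \<Longrightarrow> deg G v > 0"
  shows "K_mat G vs as * mat_adjoint (K_mat G vs as) = 1\<^sub>m (length vs)"
  unfolding K_mat_def mat_adjoint_mat_on mat_on_mult[OF assms(2)] one_mat_on[OF assms(1)]
proof (rule mat_on_cong)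
  fix v w assume v: "v \<in> set vs"
  define k where "k = (\<lambda>v (a :: 'a \<times> 'a). if v = snd a then 1 / complex_of_real (sqrt (real (deg G (snd a)))) else 0)"
  have "(\<Sum>a\<in>set as. k v a * cnj (k w a))
      = (\<Sum>a\<in>{a \<in> sym_arcs G. snd a = v}. if v = w then 1 / of_nat (deg G v) else 0)"
    using assms(3) finite_sym_arcs
    by (intro sum.mono_neutral_cong_right) (auto simp: k_def simp flip: of_real_mult)
  also have "\<dots> = (if v = w then 1 else 0)"
    using assms(4)[OF v] by (auto simp flip: deg_eq_card_in_arcs)
  finally show "(\<Sum>a\<in>set as. (if v = snd a then 1 / complex_of_real (sqrt (real (deg G (snd a)))) else 0)
        * cnj (if w = snd a then 1 / complex_of_real (sqrt (real (deg G (snd a)))) else 0))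
      = (if v = w then 1 else 0)"
    by (simp only: k_def)
qed

text \<open>Multiplication by \<open>S\<close> moves the support of row \<open>v\<close> from the
  arcs ending in \<open>v\<close> to those starting there. Pairing with row \<open>w\<close> leaves
  only the arc \<open>(v, w)\<close>, if present, whose phase is the entry of the Hermitian
  adjacency matrix.\<close>

lemma K_S_K_eq_H_norm:
  assumes "distinct vs" "distinct as" "set as = sym_arcs G"
  shows "K_mat G vs as * S_mat (eta_fun G \<eta>) as * mat_adjoint (K_mat G vs as) = H_norm G \<eta> vs"
proof -
  define d where "d = (\<lambda>v. 1 / complex_of_real (sqrt (real (deg G v))))"
  define \<theta> where "\<theta> = eta_fun G \<eta>"
  have fin: "finite (sym_arcs G)" by (rule finite_sym_arcs)
  have "K_mat G vs as * S_mat \<theta> as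
      = mat_on vs as (\<lambda>v b. if v = fst b then d v * cis (\<theta> b) else 0)"
    unfolding K_mat_def S_mat_def mat_on_mult[OF assms(2)]
  proof (rule mat_on_cong)
    fix v b assume "b \<in> set as"
    then have "prod.swap b \<in> set as" using assms(3) by simp
    then show "(\<Sum>a\<in>set as. (if v = snd a then 1 / complex_of_real (sqrt (real (deg G (snd a)))) else 0)
        * (if a = prod.swap b then cis (\<theta> b) else 0)) = (if v = fst b then d v * cis (\<theta> b) else 0)"
      by (subst sum.mono_neutral_right[of _ "{prod.swap b}"]) (auto simp: d_def)
  qed
  then have "K_mat G vs as * S_mat \<theta> as * mat_adjoint (K_mat G vs as)
      = mat_on vs vs (\<lambda>v w. \<Sum>b\<in>set as. (if v = fst b then d v * cis (\<theta> b) else 0)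
          * cnj (if w = snd b then 1 / complex_of_real (sqrt (real (deg G (snd b)))) else 0))"
    by (simp add: K_mat_def mat_adjoint_mat_on mat_on_mult[OF assms(2)])
  also have "\<dots> = mat_on vs vs (\<lambda>v w. if (v, w) \<in> sym_arcs G then d v * cis (\<theta> (v, w)) * d w else 0)"
  proof (rule mat_on_cong)
    fix v w
    have "(\<Sum>b\<in>set as. (if v = fst b then d v * cis (\<theta> b) else 0)
          * cnj (if w = snd b then 1 / complex_of_real (sqrt (real (deg G (snd b)))) else 0))
        = (\<Sum>b\<in>{b. b = (v, w) \<and> b \<in> sym_arcs G}. d v * cis (\<theta> b) * d w)"
      using fin by (intro sum.mono_neutral_cong_right) (auto simp: d_def assms(3))
    also have "{b. b = (v, w) \<and> b \<in> sym_arcs G} = (if (v, w) \<in> sym_arcs G then {(v, w)} else {})"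
      by auto
    finally show "(\<Sum>b\<in>set as. (if v = fst b then d v * cis (\<theta> b) else 0)
          * cnj (if w = snd b then 1 / complex_of_real (sqrt (real (deg G (snd b)))) else 0))
        = (if (v, w) \<in> sym_arcs G then d v * cis (\<theta> (v, w)) * d w else 0)"
      by simp
  qed
  also have "\<dots> = H_norm G \<eta> vs"
  proof -
    have D: "D_inv_sqrt G vs = mat_on vs vs (\<lambda>x y. if x = y then d x else 0)"
      unfolding D_inv_sqrt_def d_def ..
    have l: "mat_on vs vs (\<lambda>x y. if x = y then d x else 0) * mat_on vs vs f = mat_on vs vs (\<lambda>x y. d x * f x y)" for f
      unfolding mat_on_mult[OF assms(1)]
      by (rule mat_on_cong) (auto simp: if_distrib[of "\<lambda>x. x * _"] cong: if_cong)
    have r: "mat_on vs vs f * mat_on vs vs (\<lambda>x y. if x = y then d x else 0) = mat_on vs vs (\<lambda>x y. f x y * d y)" for f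
      unfolding mat_on_mult[OF assms(1)]
      by (rule mat_on_cong) (auto simp: if_distrib cong: if_cong)
    show ?thesis
      unfolding H_norm_def D H_mat_def l r
      by (rule mat_on_cong) (auto simp: sym_arcs_def \<theta>_def eta_fun_def)
  qed
  finally show ?thesis by (simp add: \<theta>_def)
qed

end

text \<open>The assumption of at least one arc excludes the single vertex, for which the formula
  fails: there \<open>U_mat\<close> is an empty matrix, while the eigenvalue 0 of
  \<open>H_norm\<close> contributes the two points \<open>cis (pi / 2)\<close> and
  \<open>cis (- pi / 2)\<close>.\<close>

theorem theorem4p3:
  fixes G :: "'a pair_pre_digraph" and \<eta> :: real
    and \<theta> :: "'a \<times> 'a \<Rightarrow> real"
    and vs :: "'a list" and as :: "('a \<times> 'a) list"
    and m_pos m_neg :: nat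
  assumes "pair_digraph G"
    and "Digraph_Component.connected (with_proj G)"
    and "parcs G \<noteq> {}"
    and "distinct vs" "set vs = pverts G"
    and "distinct as" "set as = sym_arcs G"
    and "\<theta> = eta_fun G \<eta>"
    and "m_pos = count (Spec (H_norm G \<eta> vs)) 1"
    and "m_neg = count (Spec (H_norm G \<eta> vs)) (-1)"
  shows "Spec (U_mat G \<theta> vs as) =
           phi_preimage (Spec (H_norm G \<eta> vs))
           + replicate_mset (extra_mult G m_pos) 1
           + replicate_mset (extra_mult G m_neg) (-1)"
proof -
  interpret pair_digraph G by fact
  define n e where "n = length vs" and "e = card (sym_edges G)"
  obtain os where os: "distinct os" "length os = e" "set os \<subseteq> sym_arcs G"
    "\<And>a. a \<in> sym_arcs G \<Longrightarrow> a \<in> set os \<longleftrightarrow> prod.swap a \<notin> set os"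
    using orientation_exists unfolding e_def by blast
  have n: "n = card (pverts G)"
    using assms(4,5) by (simp add: n_def flip: distinct_card)
  have len: "length as = 2 * e"
    using assms(6,7) card_sym_arcs by (simp add: e_def flip: distinct_card)
  define u where "u = (\<lambda>a. cis (\<theta> a))"
  have u: "u (prod.swap a) = cnj (u a)" "u a * cnj (u a) = 1" for a
    by (simp_all add: u_def assms(8) cis_eta_fun_swap cis_cnj cis_mult del: swap_simp)
  define K S P Q where "K = K_mat G vs as" and "S = S_mat \<theta> as"
    and "P = half_arc_mat u 1 as os" and "Q = half_arc_mat u (-1) as os"
  have K: "K \<in> carrier_mat n (2 * e)" and P: "P \<in> carrier_mat (2 * e) e" and Q: "Q \<in> carrier_mat (2 * e) e"
    using mat_on_carrier os(2)
    by (auto simp: K_def K_mat_def P_def Q_def half_arc_mat_def n_def len[symmetric])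
  have "K * mat_adjoint K = 1\<^sub>m n"
    unfolding K_def n_def using assms deg_pos by (intro K_mat_mult_adjoint) auto
  \<comment> \<open>Both factorizations are instances of the product \<open>1 + c S\<close>, with
    \<open>c = 1\<close> here and \<open>c = -1\<close> next.\<close>
  moreover have "S = P * mat_adjoint P - 1\<^sub>m (2 * e)"
    using half_arc_mat_mult_adjoint[of u, OF u _ assms(6,7) os(1,3,4), of 1]
    by (simp add: P_def S_def S_mat_def u_def one_mat_on assms(6) minus_mat_on cong: if_cong flip: len)
  moreover have "S = 1\<^sub>m (2 * e) - Q * mat_adjoint Q"
    using half_arc_mat_mult_adjoint[of u, OF u _ assms(6,7) os(1,3,4), of "-1"]
    by (auto simp: Q_def S_def S_mat_def u_def one_mat_on assms(6) minus_mat_on simp flip: len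
          intro!: mat_on_cong)
  moreover have "mat_adjoint Q * Q = 2 \<cdot>\<^sub>m 1\<^sub>m e"
    using adjoint_mult_half_arc_mat[of u, OF u _ assms(6,7) os(1,3,4), of "-1"] os(2)
    by (simp add: Q_def)
  moreover have "K * S * mat_adjoint K = H_norm G \<eta> vs"
    using K_S_K_eq_H_norm[OF assms(4,6,7)] by (simp add: K_def S_def assms(8))
  moreover have "U_mat G \<theta> vs as = S * (2 \<cdot>\<^sub>m (mat_adjoint K * K) - 1\<^sub>m (2 * e))"
    by (simp add: U_mat_def C_mat_def K_def S_def len)
  ultimately show ?thesis
    using Spec_transfer[OF K P Q, of S] by (simp add: assms(9,10) extra_mult_def n e_def)
qed

end
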